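(* Let $f_1,\dots,f_m:\mathbb{R}^d\to\mathbb{R}$ each be convex and $L$-smooth, let $G:\mathbb{R}^d\to\mathbb{R}\cup\{\pm\infty\}$ be proper, closed and convex, and let $x^\star$ be an optimal solution of $\min_{x\in\mathbb{R}^d}F(x)+G(x)$ with $F=\frac1m\sum_{i=1}^mf_i$; put $X^\star=1(x^\star)^\top$. Let $C,D\in\mathbb{S}^m$ satisfy: $1^\top D1=m$; $C\succeq0$ and $\mathrm{Null}(C)=\mathrm{span}(1)$; $0\prec D\preceq I-\frac C2$. Let $X^0\in\mathbb{R}^{m\times d}$ be arbitrary, $\underline Y^0=0$, and for $k\ge0$ $$\underline X^{k+1}=DX^k-\gamma\big(\nabla f(X^k)+\underline Y^k\big),\qquad X^{k+1}=\mathrm{prox}_{\gamma g}(\underline X^{k+1}),\qquad \underline Y^{k+1}=\underline Y^k+\frac1\gamma CX^{k+1}.$$ If $0<\gamma<\frac{\lambda_{\min}(D)}{L}$, then for every $k\ge1$, with $\widehat X^k=\frac1k\sum_{t=1}^kX^t$, $$M(\widehat X^k)\le\frac1k\left(\frac1{2\gamma}\|X^0-X^\star\|_D^2+2\gamma\,\frac1{\lambda_2(C)}\|\nabla f(X^\star)\|^2\right),$$ where $$M(X)=\max\big\{\|(I-J)X\|\,\|Y^\star\|,\;|(f+g)(X)-(f+g)(X^\star)|\big\},\qquad Y^\star=-\big(\nabla f(X^\star)+1(\xi^\star)^\top\big),$$ and $\xi^\star\in\partial G(x^\star)$ is such that $\xi^\star+\nabla F(x^\star)=0$.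
   Context: $\mathbb{S}^m$ is the set of real symmetric $m\times m$ matrices; $\preceq,\prec$ denote the Loewner order. $1\in\mathbb{R}^m$ is the all-ones vector and $J=\frac1m11^\top$. For $X=[x_1,\dots,x_m]^\top\in\mathbb{R}^{m\times d}$ (row $i$ is $x_i^\top$), $f(X)=\sum_{i=1}^m f_i(x_i)$, $g(X)=\sum_{i=1}^mG(x_i)$, $\nabla f(X)=[\nabla f_1(x_1),\dots,\nabla f_m(x_m)]^\top$, and $\mathrm{prox}_{\gamma g}(X)=\arg\min_{Y\in\mathbb{R}^{m\times d}} g(Y)+\frac1{2\gamma}\|X-Y\|^2$. "$L$-smooth" means differentiable with $L$-Lipschitz gradient; $\partial G$ is the convex subdifferential. $\|\cdot\|$ is the Frobenius norm and $\|X\|_D^2=\mathrm{tr}(X^\top DX)$. $\lambda_{\min}$ is the smallest eigenvalue and $\lambda_2(C)$ the second smallest eigenvalue of $C$. *)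

theory Defs
  imports "HOL-Analysis.Analysis" "HOL-Library.Multiset"
begin

section \<open>Smooth functions\<close>

definition gradient :: "('a::real_inner \<Rightarrow> real) \<Rightarrow> 'a \<Rightarrow> 'a" where
  "gradient f x = (THE v. GDERIV f x :> v)"

definition L_smooth :: "real \<Rightarrow> ('a::real_inner \<Rightarrow> real) \<Rightarrow> bool" where
  "L_smooth L f \<longleftrightarrow> (\<forall>x. f differentiable (at x)) \<and> L-lipschitz_on UNIV (gradient f)"

section \<open>Extended-real-valued convex functions\<close>

definition proper_fun :: "('a \<Rightarrow> ereal) \<Rightarrow> bool" where
  "proper_fun G \<longleftrightarrow> (\<forall>x. G x \<noteq> -\<infinity>) \<and> (\<exists>x. G x \<noteq> \<infinity>)"

text \<open>The epigraph has real heights, so it is a subset of a real vector space even though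
  \<open>G\<close> may take infinite values.\<close>

definition ereal_epigraph :: "('a \<Rightarrow> ereal) \<Rightarrow> ('a \<times> real) set" where
  "ereal_epigraph G = {(x, t). G x \<le> ereal t}"

definition closed_fun :: "('a::topological_space \<Rightarrow> ereal) \<Rightarrow> bool" where
  "closed_fun G \<longleftrightarrow> closed (ereal_epigraph G)"

definition convex_fun :: "('a::real_vector \<Rightarrow> ereal) \<Rightarrow> bool" where
  "convex_fun G \<longleftrightarrow> convex (ereal_epigraph G)"

definition subdifferential :: "('a::real_inner \<Rightarrow> ereal) \<Rightarrow> 'a \<Rightarrow> 'a set" where
  "subdifferential G x = {\<xi>. \<forall>y. G x + ereal (\<xi> \<bullet> (y - x)) \<le> G y}"

definition prox :: "real \<Rightarrow> ('a::real_normed_vector \<Rightarrow> ereal) \<Rightarrow> 'a \<Rightarrow> 'a" where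
  "prox \<gamma> g X = (ARG_MIN (\<lambda>Y. g Y + ereal (1 / (2 * \<gamma>) * (norm (X - Y))\<^sup>2)) Y. True)"

section \<open>Matrices\<close>

text \<open>A real matrix with rows indexed by \<open>'m\<close> and columns by \<open>'d\<close> has type \<open>real^'d^'m\<close>, and
  \<open>X $ i\<close> is its \<open>i\<close>-th row. The library norm on this type is the Frobenius norm; the all-ones
  vector is \<open>1 :: real^'m\<close>, whereas the identity matrix is \<open>mat 1\<close>.\<close>

definition outer :: "real^'m \<Rightarrow> real^'d \<Rightarrow> real^'d^'m" where
  "outer u v = (\<chi> i j. u $ i * v $ j)"

definition avg_mat :: "real^'m^'m" where
  "avg_mat = (1 / real CARD('m)) *\<^sub>R outer 1 1"

definition symmetric_mat :: "real^'m^'m \<Rightarrow> bool" where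
  "symmetric_mat A \<longleftrightarrow> transpose A = A"

text \<open>The Loewner order; it is only used for symmetric matrices.\<close>

definition loewner_le :: "real^'m^'m \<Rightarrow> real^'m^'m \<Rightarrow> bool" where
  "loewner_le A B \<longleftrightarrow> (\<forall>v. 0 \<le> v \<bullet> ((B - A) *v v))"

definition loewner_less :: "real^'m^'m \<Rightarrow> real^'m^'m \<Rightarrow> bool" where
  "loewner_less A B \<longleftrightarrow> (\<forall>v. v \<noteq> 0 \<longrightarrow> 0 < v \<bullet> ((B - A) *v v))"

definition null_space :: "real^'m^'m \<Rightarrow> (real^'m) set" where
  "null_space A = {v. A *v v = 0}"

definition sq_norm_wrt :: "real^'m^'m \<Rightarrow> real^'d^'m \<Rightarrow> real" where
  "sq_norm_wrt D X = trace (transpose X ** D ** X)"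

definition eigenspace :: "real^'m^'m \<Rightarrow> real \<Rightarrow> (real^'m) set" where
  "eigenspace A c = {v. A *v v = c *\<^sub>R v}"

definition eigenvalues :: "real^'m^'m \<Rightarrow> real set" where
  "eigenvalues A = {c. \<exists>v. v \<noteq> 0 \<and> A *v v = c *\<^sub>R v}"

text \<open>Eigenvalues in increasing order, each repeated according to its geometric multiplicity,
  which for symmetric matrices is also the algebraic one.\<close>

definition sorted_eigenvalues :: "real^'m^'m \<Rightarrow> real list" where
  "sorted_eigenvalues A =
     sorted_list_of_multiset (\<Sum>c\<in>eigenvalues A. replicate_mset (dim (eigenspace A c)) c)"

definition lambda_min :: "real^'m^'m \<Rightarrow> real" where
  "lambda_min A = Min (eigenvalues A)"

definition lambda_2 :: "real^'m^'m \<Rightarrow> real" where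
  "lambda_2 A = sorted_eigenvalues A ! 1"

section \<open>The composite problem\<close>

definition avg_fun :: "('m::finite \<Rightarrow> real^'d \<Rightarrow> real) \<Rightarrow> real^'d \<Rightarrow> real" where
  "avg_fun f x = (1 / real CARD('m)) * (\<Sum>i\<in>UNIV. f i x)"

definition stack_fun :: "('m::finite \<Rightarrow> real^'d \<Rightarrow> real) \<Rightarrow> real^'d^'m \<Rightarrow> real" where
  "stack_fun f X = (\<Sum>i\<in>UNIV. f i (X $ i))"

definition stack_gradient :: "('m::finite \<Rightarrow> real^'d \<Rightarrow> real) \<Rightarrow> real^'d^'m \<Rightarrow> real^'d^'m" where
  "stack_gradient f X = (\<chi> i. gradient (f i) (X $ i))"

definition stack_reg :: "(real^'d \<Rightarrow> ereal) \<Rightarrow> real^'d^'m \<Rightarrow> ereal" where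
  "stack_reg G X = (\<Sum>i\<in>UNIV. G (X $ i))"

definition composite :: "('m::finite \<Rightarrow> real^'d \<Rightarrow> real) \<Rightarrow> (real^'d \<Rightarrow> ereal) \<Rightarrow> real^'d^'m \<Rightarrow> ereal" where
  "composite f G X = ereal (stack_fun f X) + stack_reg G X"

definition merit ::
  "('m::finite \<Rightarrow> real^'d \<Rightarrow> real) \<Rightarrow> (real^'d \<Rightarrow> ereal) \<Rightarrow> real^'d^'m \<Rightarrow> real^'d^'m \<Rightarrow> real^'d^'m \<Rightarrow> ereal"
  where
  "merit f G Xs Ys X =
     max (ereal (norm ((mat 1 - avg_mat) ** X) * norm Ys))
         \<bar>composite f G X - composite f G Xs\<bar>"

end

theory Submission
  imports Defs
begin

text \<open>
  The dual iterates are written as \<open>C ** Z k\<close>, so no pseudoinverse of \<open>C\<close> occurs. The optimality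
  condition of the proximal step, convexity and the descent lemma give, for every \<open>Y = C ** W\<close>,
  that \<open>(f + g)(X (k+1)) - (f + g)(Xs) + Y \<bullet> X (k+1)\<close> is at most the decrease of a Lyapunov function;
  summation and Jensen's inequality bound the Lagrangian gap at the ergodic average. Choosing \<open>Y\<close>
  along the consensus error with norm at most \<open>2 * norm Ys\<close> and combining with the saddle-point
  inequality for \<open>Ys\<close> controls both terms of the merit function. The constant \<open>lambda_2 C\<close> enters
  through the Rayleigh quotient of \<open>C\<close> on the complement of the all-ones vector.
\<close>

section \<open>Gradients\<close>

text \<open>The Riesz vector of the derivative is its adjoint applied to 1; uniqueness of the
  derivative makes the \<open>THE\<close> in \<open>gradient\<close> well defined.\<close>

lemma GDERIV_gradient:
  fixes f :: "'a::euclidean_space \<Rightarrow> real"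
  assumes "f differentiable (at x)"
  shows "GDERIV f x :> gradient f x"
proof -
  obtain f' where f': "(f has_derivative f') (at x)"
    using assms by (auto simp: differentiable_def)
  then have lin: "linear f'" by (rule has_derivative_linear)
  have "f' = (\<lambda>h. h \<bullet> adjoint f' 1)"
  proof
    fix h show "f' h = h \<bullet> adjoint f' 1"
      using adjoint_works[OF lin, of h 1] by simp
  qed
  then have ex: "GDERIV f x :> adjoint f' 1"
    using f' by (simp add: gderiv_def)
  show ?thesis
    unfolding gradient_def
  proof (rule theI[of "\<lambda>v. GDERIV f x :> v", OF ex])
    fix v assume "GDERIV f x :> v"
    then have "(\<lambda>h. h \<bullet> v) = (\<lambda>h. h \<bullet> adjoint f' 1)"
      using ex unfolding gderiv_def by (metis has_derivative_unique)
    then show "v = adjoint f' 1"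
      by (auto simp: fun_eq_iff vector_eq_ldot)
  qed
qed

lemma gradient_eqI:
  fixes f :: "'a::euclidean_space \<Rightarrow> real"
  assumes "GDERIV f x :> v"
  shows "gradient f x = v"
proof -
  have "f differentiable (at x)"
    using assms by (auto simp: gderiv_def differentiable_def)
  then have "GDERIV f x :> gradient f x" by (rule GDERIV_gradient)
  then have "(\<lambda>h. h \<bullet> v) = (\<lambda>h. h \<bullet> gradient f x)"
    using assms unfolding gderiv_def by (metis has_derivative_unique)
  then show ?thesis by (auto simp: fun_eq_iff vector_eq_ldot)
qed

lemma DERIV_along_line:
  fixes f :: "'a::euclidean_space \<Rightarrow> real"
  assumes "f differentiable (at (x + t *\<^sub>R d))"
  shows "((\<lambda>t. f (x + t *\<^sub>R d)) has_real_derivative gradient f (x + t *\<^sub>R d) \<bullet> d) (at t)"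
proof -
  have f: "(f has_derivative (\<lambda>h. h \<bullet> gradient f (x + t *\<^sub>R d))) (at (x + t *\<^sub>R d))"
    using GDERIV_gradient[OF assms] by (simp add: gderiv_def)
  have "((\<lambda>t. f (x + t *\<^sub>R d)) has_derivative (\<lambda>s. (s *\<^sub>R d) \<bullet> gradient f (x + t *\<^sub>R d))) (at t)"
    by (rule has_derivative_compose[of "\<lambda>t. x + t *\<^sub>R d", OF _ f]) (auto intro!: derivative_eq_intros)
  then show ?thesis
    by (simp add: has_field_derivative_def inner_commute mult.commute[of _ "_ \<bullet> _"])
qed

lemma convex_on_gradient_le:
  fixes f :: "'a::euclidean_space \<Rightarrow> real"
  assumes "convex_on UNIV f" "f differentiable (at x)"
  shows "f x + gradient f x \<bullet> (y - x) \<le> f y"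
proof -
  define \<phi> where "\<phi> t = f (x + t *\<^sub>R (y - x))" for t :: real
  have "convex_on UNIV \<phi>"
  proof (rule convex_onI)
    fix t u v :: real assume t: "0 < t" "t < 1"
    have "x + ((1 - t) *\<^sub>R u + t *\<^sub>R v) *\<^sub>R (y - x)
        = (1 - t) *\<^sub>R (x + u *\<^sub>R (y - x)) + t *\<^sub>R (x + v *\<^sub>R (y - x))"
      by (simp add: algebra_simps)
    then show "\<phi> ((1 - t) *\<^sub>R u + t *\<^sub>R v) \<le> (1 - t) * \<phi> u + t * \<phi> v"
      unfolding \<phi>_def using convex_onD[OF assms(1)] t by simp
  qed simp
  moreover have "(\<phi> has_real_derivative gradient f x \<bullet> (y - x)) (at 0)"
    using DERIV_along_line[of f x 0 "y - x"] assms(2) by (simp add: \<phi>_def[abs_def])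
  ultimately have "\<phi> 1 - \<phi> 0 \<ge> (gradient f x \<bullet> (y - x)) * (1 - 0)"
    by (intro convex_on_imp_above_tangent[where A=UNIV]) auto
  then show ?thesis by (simp add: \<phi>_def)
qed

lemma L_smooth_descent:
  fixes f :: "'a::euclidean_space \<Rightarrow> real"
  assumes "L_smooth L f"
  shows "f y \<le> f x + gradient f x \<bullet> (y - x) + L / 2 * (norm (y - x))\<^sup>2"
proof -
  define d where "d = y - x"
  \<comment> \<open>Up to the constant \<open>f x\<close>, \<open>\<psi>\<close> is the excess of
    \<open>f\<close> on the segment over its quadratic model; the Lipschitz bound makes its
    derivative nonpositive.\<close>
  define \<psi> where "\<psi> t = f (x + t *\<^sub>R d) - t * (gradient f x \<bullet> d) - L / 2 * t\<^sup>2 * (norm d)\<^sup>2" for t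
  have diff: "f differentiable (at z)" for z
    using assms by (auto simp: L_smooth_def)
  have lip: "norm (gradient f u - gradient f v) \<le> L * norm (u - v)" for u v
    using assms lipschitz_onD[of L UNIV "gradient f" u v] by (auto simp: L_smooth_def dist_norm)
  have "\<psi> 1 \<le> \<psi> 0"
  proof (rule DERIV_nonpos_imp_nonincreasing[OF zero_le_one])
    fix t :: real assume t: "0 \<le> t" "t \<le> 1"
    let ?\<psi>' = "gradient f (x + t *\<^sub>R d) \<bullet> d - gradient f x \<bullet> d - L * t * (norm d)\<^sup>2"
    have "(\<psi> has_real_derivative ?\<psi>') (at t)"
      unfolding \<psi>_def by (auto intro!: derivative_eq_intros DERIV_along_line diff)
    moreover have "(gradient f (x + t *\<^sub>R d) - gradient f x) \<bullet> d \<le> L * t * (norm d)\<^sup>2"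
    proof -
      have "(gradient f (x + t *\<^sub>R d) - gradient f x) \<bullet> d
          \<le> norm (gradient f (x + t *\<^sub>R d) - gradient f x) * norm d"
        by (rule norm_cauchy_schwarz)
      also have "\<dots> \<le> (L * norm (t *\<^sub>R d)) * norm d"
        using lip[of "x + t *\<^sub>R d" x] by (intro mult_right_mono) auto
      finally show ?thesis using t by (simp add: power2_eq_square mult_ac)
    qed
    ultimately show "\<exists>y. (\<psi> has_real_derivative y) (at t) \<and> y \<le> 0"
      by (intro exI[of _ ?\<psi>']) (auto simp: inner_diff_left)
  qed
  then show ?thesis by (simp add: \<psi>_def d_def)
qed

lemma gradient_avg_fun:
  assumes "\<And>i. f i differentiable (at x)"
  shows "gradient (avg_fun f) x
    = (1 / real CARD('m)) *\<^sub>R (\<Sum>i\<in>UNIV. gradient (f (i::'m::finite)) x)"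
proof (rule gradient_eqI)
  have "(f i has_derivative (\<lambda>h. h \<bullet> gradient (f i) x)) (at x)" for i
    using GDERIV_gradient[OF assms] by (simp add: gderiv_def)
  then have "((\<lambda>x. (1 / real CARD('m)) *\<^sub>R (\<Sum>i\<in>UNIV. f i x)) has_derivative
      (\<lambda>h. (1 / real CARD('m)) *\<^sub>R (\<Sum>i\<in>UNIV. h \<bullet> gradient (f i) x))) (at x)"
    by (intro has_derivative_scaleR_right has_derivative_sum) auto
  then show "GDERIV (avg_fun f) x :> (1 / real CARD('m)) *\<^sub>R (\<Sum>i\<in>UNIV. gradient (f i) x)"
    by (simp add: gderiv_def avg_fun_def[abs_def] inner_sum_right)
qed

section \<open>Symmetric matrices\<close>

lemma symmetric_mat_inner:
  fixes A :: "real^'n^'n"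
  assumes "symmetric_mat A"
  shows "(A *v v) \<bullet> w = v \<bullet> (A *v w)"
  using assms by (metis dot_lmul_matrix symmetric_mat_def vector_transpose_matrix)

text \<open>The linear term dominates as \<open>s\<close> tends to 0; this turns minimality along a
  segment into a first-order condition.\<close>

lemma nonneg_if_quadratic_nonneg:
  fixes a c :: real
  assumes "\<And>s. 0 < s \<Longrightarrow> s \<le> 1 \<Longrightarrow> 0 \<le> s * a + s\<^sup>2 * c"
  shows "0 \<le> a"
proof (rule ccontr)
  assume "\<not> 0 \<le> a"
  then have a: "a < 0" by simp
  define s where "s = - a / (1 + \<bar>a\<bar> + \<bar>c\<bar>)"
  have s: "0 < s" "s \<le> 1" using a by (auto simp: s_def field_simps)
  have "0 \<le> s * (a + s * c)" using assms[OF s] by (simp add: algebra_simps power2_eq_square)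
  then have "0 \<le> a + s * c" using s by (simp add: zero_le_mult_iff)
  moreover have "s * c \<le> s * \<bar>c\<bar>" using s by (intro mult_left_mono) auto
  moreover have "s * \<bar>c\<bar> < - a"
  proof -
    have "s * \<bar>c\<bar> < s * (1 + \<bar>a\<bar> + \<bar>c\<bar>)" using s by (intro mult_strict_left_mono) auto
    also have "\<dots> = - a" by (simp add: s_def)
    finally show ?thesis .
  qed
  ultimately show False by simp
qed

text \<open>\<open>v\<close> minimises the form on \<open>S\<close>, so its first variation is
  nonnegative along both \<open>u\<close> and \<open>- u\<close>, hence zero.\<close>

lemma psd_on_subspace_null:
  fixes A :: "real^'n^'n"
  assumes sym: "symmetric_mat A" and S: "subspace S"
    and psd: "\<And>w. w \<in> S \<Longrightarrow> 0 \<le> w \<bullet> (A *v w)"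
    and v: "v \<in> S" "v \<bullet> (A *v v) = 0" and u: "u \<in> S"
  shows "u \<bullet> (A *v v) = 0"
proof -
  have nonneg: "0 \<le> w \<bullet> (A *v v)" if w: "w \<in> S" for w
  proof -
    have "0 \<le> s * (2 * (w \<bullet> (A *v v))) + s\<^sup>2 * (w \<bullet> (A *v w))" for s :: real
    proof -
      have "v + s *\<^sub>R w \<in> S" using S v w by (simp add: subspace_add subspace_scale)
      from psd[OF this] show ?thesis
        using v symmetric_mat_inner[OF sym, of v w]
        by (simp add: matrix_vector_right_distrib matrix_vector_mult_scaleR inner_add_left
            inner_add_right inner_commute algebra_simps power2_eq_square)
    qed
    then have "0 \<le> 2 * (w \<bullet> (A *v v))" using nonneg_if_quadratic_nonneg by blast
    then show ?thesis by simp
  qed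
  have "0 \<le> (- u) \<bullet> (A *v v)" using S u nonneg[of "- u"] subspace_neg by blast
  with nonneg[OF u] show ?thesis by simp
qed

lemma psd_null:
  fixes A :: "real^'n^'n"
  assumes "symmetric_mat A" "\<And>w. 0 \<le> w \<bullet> (A *v w)" "v \<bullet> (A *v v) = 0"
  shows "A *v v = 0"
  using psd_on_subspace_null[OF assms(1) subspace_UNIV, of v "A *v v"] assms by simp

text \<open>If \<open>v\<close> minimises the Rayleigh quotient on \<open>S\<close>, with minimum \<open>\<mu>\<close>, then \<open>A - \<mu> I\<close> is positive
  semidefinite on \<open>S\<close> and its quadratic form vanishes at \<open>v\<close>.\<close>

lemma Rayleigh_eigenvector:
  fixes A :: "real^'n^'n"
  assumes sym: "symmetric_mat A" and S: "subspace S" "S \<noteq> {0}"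
    and inv: "\<And>v. v \<in> S \<Longrightarrow> A *v v \<in> S"
  obtains v \<mu> where "v \<in> S" "v \<noteq> 0" "A *v v = \<mu> *\<^sub>R v"
    "\<And>w. w \<in> S \<Longrightarrow> \<mu> * (norm w)\<^sup>2 \<le> w \<bullet> (A *v w)"
proof -
  have cl: "compact (sphere 0 1 \<inter> S)"
    using S(1) by (intro compact_Int_closed compact_sphere closed_subspace)
  obtain w0 where "w0 \<in> S" "w0 \<noteq> 0" using S subspace_0 by blast
  then have "(1 / norm w0) *\<^sub>R w0 \<in> sphere 0 1 \<inter> S"
    using S(1) by (auto simp: subspace_scale)
  then have ne: "sphere 0 1 \<inter> S \<noteq> {}" by blast
  have cont: "continuous_on (sphere 0 1 \<inter> S) (\<lambda>v. v \<bullet> (A *v v))"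
    by (intro continuous_intros linear_continuous_on) (auto intro: linear_linear[THEN iffD2])
  obtain v where v: "v \<in> sphere 0 1 \<inter> S"
    and vmin: "\<And>w. w \<in> sphere 0 1 \<inter> S \<Longrightarrow> v \<bullet> (A *v v) \<le> w \<bullet> (A *v w)"
    using continuous_attains_inf[OF cl ne cont] by blast
  define \<mu> where "\<mu> = v \<bullet> (A *v v)"
  have nv: "norm v = 1" "v \<in> S" using v by auto
  have ray: "\<mu> * (norm w)\<^sup>2 \<le> w \<bullet> (A *v w)" if "w \<in> S" for w
  proof (cases "w = 0")
    case False
    then have "(1 / norm w) *\<^sub>R w \<in> sphere 0 1 \<inter> S"
      using S(1) that by (auto simp: subspace_scale)
    from vmin[OF this] have "\<mu> \<le> (w \<bullet> (A *v w)) / (norm w)\<^sup>2"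
      by (simp add: \<mu>_def matrix_vector_mult_scaleR power2_eq_square)
    then show ?thesis using False by (simp add: field_simps)
  qed simp
  define B where "B = A - \<mu> *\<^sub>R mat 1"
  have B: "B *v w = A *v w - \<mu> *\<^sub>R w" for w
    by (simp add: B_def matrix_vector_mult_diff_rdistrib scaleR_matrix_vector_assoc[symmetric])
  have "symmetric_mat B"
    using sym unfolding symmetric_mat_def B_def
    by (simp add: vec_eq_iff transpose_def mat_def)
  moreover have "B *v v \<in> S"
    using S(1) nv inv by (simp add: B subspace_diff subspace_scale)
  moreover have "0 \<le> w \<bullet> (B *v w)" if "w \<in> S" for w
    using ray[OF that] by (simp add: B inner_diff_right dot_square_norm)
  moreover have "v \<bullet> (B *v v) = 0"
    using nv by (simp add: B \<mu>_def inner_diff_right dot_square_norm)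
  \<comment> \<open>Invariance of \<open>S\<close> admits \<open>B *v v\<close> itself as the test
    direction.\<close>
  ultimately have "(B *v v) \<bullet> (B *v v) = 0"
    using nv S(1) psd_on_subspace_null by blast
  then have "A *v v = \<mu> *\<^sub>R v" by (simp add: B)
  moreover have "v \<noteq> 0" using nv by auto
  ultimately show thesis using that nv ray by blast
qed

text \<open>Eigenvectors of distinct eigenvalues are orthogonal, hence independent. Finiteness gives
  \<open>Min\<close> and the multiset sum over \<open>eigenvalues A\<close> their intended
  values.\<close>

lemma finite_eigenvalues:
  fixes A :: "real^'n^'n"
  assumes sym: "symmetric_mat A"
  shows "finite (eigenvalues A)"
proof -
  define V where "V c = (SOME v. v \<noteq> 0 \<and> A *v v = c *\<^sub>R v)" for c
  have V: "V c \<noteq> 0 \<and> A *v V c = c *\<^sub>R V c" if "c \<in> eigenvalues A" for c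
    unfolding V_def by (rule someI_ex) (use that in \<open>auto simp: eigenvalues_def\<close>)
  have orth: "V c \<bullet> V e = 0" if "c \<in> eigenvalues A" "e \<in> eigenvalues A" "c \<noteq> e" for c e
    using symmetric_mat_inner[OF sym, of "V c" "V e"] V[OF that(1)] V[OF that(2)] that(3) by simp
  have "pairwise orthogonal (V ` eigenvalues A)"
    using orth by (auto simp: pairwise_def orthogonal_def)
  then have "independent (V ` eigenvalues A)"
    using V by (intro pairwise_orthogonal_independent) auto
  then have "finite (V ` eigenvalues A)" by (rule independent_imp_finite)
  moreover have "inj_on V (eigenvalues A)"
  proof (rule inj_onI, rule ccontr)
    fix c e assume "c \<in> eigenvalues A" "e \<in> eigenvalues A" "V c = V e" "c \<noteq> e"
    then show False using orth[of c e] V[of e] by simp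
  qed
  ultimately show ?thesis by (simp add: finite_image_iff)
qed

text \<open>The minimum of the Rayleigh quotient over the whole space is an eigenvalue, so
  \<open>lambda_min A\<close> lies below it.\<close>

lemma lambda_min_le:
  fixes A :: "real^'n^'n"
  assumes sym: "symmetric_mat A"
  shows "lambda_min A * (norm w)\<^sup>2 \<le> w \<bullet> (A *v w)"
proof -
  have "(UNIV :: (real^'n) set) \<noteq> {0}"
  proof
    assume "(UNIV :: (real^'n) set) = {0}"
    then have "(1 :: real^'n) = 0" by blast
    then show False by simp
  qed
  then obtain v \<mu> where v: "v \<noteq> 0" "A *v v = \<mu> *\<^sub>R v"
    "\<mu> * (norm w)\<^sup>2 \<le> w \<bullet> (A *v w)"
    using Rayleigh_eigenvector[OF sym subspace_UNIV] by (metis UNIV_I)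
  then have "\<mu> \<in> eigenvalues A" by (auto simp: eigenvalues_def)
  then have "lambda_min A \<le> \<mu>"
    unfolding lambda_min_def using finite_eigenvalues[OF sym] by simp
  then have "lambda_min A * (norm w)\<^sup>2 \<le> \<mu> * (norm w)\<^sup>2" by (intro mult_right_mono) auto
  with v show ?thesis by simp
qed

section \<open>The second smallest eigenvalue\<close>

lemma one_inner_one_pos: "0 < (1 :: real^'n) \<bullet> 1"
  by (simp add: inner_vec_def)

context
  fixes C :: "real^'m^'m"
  assumes C_sym: "symmetric_mat C"
    and C_psd: "loewner_le 0 C"
    and C_null: "null_space C = span {1}"
begin

lemma mult_vec_eq_0_iff: "C *v v = 0 \<longleftrightarrow> (\<exists>c. v = c *\<^sub>R 1)"
  using C_null by (auto simp: null_space_def span_singleton set_eq_iff)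

lemma mult_vec_one: "C *v 1 = 0"
  using mult_vec_eq_0_iff by (metis scaleR_one)

lemma one_inner_mult_vec: "1 \<bullet> (C *v v) = 0"
  using symmetric_mat_inner[OF C_sym, of 1 v] by (simp add: mult_vec_one)

lemma quadratic_form_nonneg: "0 \<le> v \<bullet> (C *v v)"
  using C_psd by (simp add: loewner_le_def)

lemma null_orthogonal_one:
  assumes "C *v v = 0" "1 \<bullet> v = 0"
  shows "v = 0"
proof -
  obtain c where v: "v = c *\<^sub>R 1" using assms(1) mult_vec_eq_0_iff by blast
  with assms(2) show ?thesis using one_inner_one_pos[where 'n='m] by auto
qed

text \<open>\<open>C\<close> leaves the hyperplane orthogonal to 1 invariant, and its Rayleigh
  minimum \<open>\<mu>\<close> there is a positive eigenvalue. The one-dimensional kernel puts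
  exactly one 0 in the sorted list, so \<open>\<mu>\<close> sits at index 1.\<close>

lemma lambda_2_Rayleigh:
  assumes m: "2 \<le> CARD('m)"
  shows "0 < lambda_2 C" "\<And>w. 1 \<bullet> w = 0 \<Longrightarrow> lambda_2 C * (norm w)\<^sup>2 \<le> w \<bullet> (C *v w)"
proof -
  let ?S = "{v :: real^'m. 1 \<bullet> v = 0}"
  have S: "subspace ?S" by (rule subspace_hyperplane)
  have "?S \<noteq> {0}"
  proof
    assume S0: "?S = {0}"
    have "dim ?S = CARD('m) - 1"
      using dim_hyperplane[of "1 :: real^'m"] one_inner_one_pos[where 'n='m] by auto
    then show False using m unfolding S0 by simp
  qed
  then obtain v \<mu> where v: "v \<in> ?S" "v \<noteq> 0" "C *v v = \<mu> *\<^sub>R v"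
    and ray: "\<And>w. w \<in> ?S \<Longrightarrow> \<mu> * (norm w)\<^sup>2 \<le> w \<bullet> (C *v w)"
    using Rayleigh_eigenvector[OF C_sym S] one_inner_mult_vec by blast
  have "\<mu> \<noteq> 0" using v null_orthogonal_one by force
  moreover have "0 \<le> \<mu>"
    using quadratic_form_nonneg[of v] v(2,3) by (simp add: dot_square_norm zero_le_mult_iff)
  ultimately have pos: "0 < \<mu>" by simp
  let ?E = "eigenvalues C"
  have fin: "finite ?E" by (rule finite_eigenvalues[OF C_sym])
  have E0: "0 \<in> ?E"
    using mult_vec_one by (auto simp: eigenvalues_def intro!: exI[of _ 1])
  have E\<mu>: "\<mu> \<in> ?E" using v by (auto simp: eigenvalues_def)
  \<comment> \<open>An eigenvector of a nonzero eigenvalue lies in the range of \<open>C\<close>, so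
    it is orthogonal to 1 and \<open>ray\<close> applies.\<close>
  have Emin: "\<mu> \<le> c" if c: "c \<in> ?E - {0}" for c
  proof -
    obtain w where w: "w \<noteq> 0" "C *v w = c *\<^sub>R w" using c by (auto simp: eigenvalues_def)
    have "w \<in> ?S" using one_inner_mult_vec[of w] w c by simp
    from ray[OF this] show ?thesis using w by (simp add: dot_square_norm)
  qed
  have dim0: "dim (eigenspace C 0) = 1"
  proof -
    have "eigenspace C 0 = span {1}"
      using C_null by (simp add: eigenspace_def null_space_def)
    then show ?thesis by (simp add: dim_span dim_singleton)
  qed
  define N where "N = (\<Sum>c\<in>?E - {0}. replicate_mset (dim (eigenspace C c)) c)"
  have M: "(\<Sum>c\<in>?E. replicate_mset (dim (eigenspace C c)) c) = add_mset 0 N"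
    using sum.remove[OF fin E0, of "\<lambda>c. replicate_mset (dim (eigenspace C c)) c"] dim0
    by (simp add: N_def)
  have N: "set_mset N \<subseteq> ?E - {0}"
    using fin by (auto simp: N_def set_mset_sum)
  have "\<mu> \<in># N"
  proof -
    have "eigenspace C \<mu> \<noteq> {0}" "0 \<in> eigenspace C \<mu>" using v by (auto simp: eigenspace_def)
    then have "0 < dim (eigenspace C \<mu>)" by (auto simp: dim_eq_0)
    then show ?thesis using fin E\<mu> pos by (auto simp: N_def set_mset_sum simp del: dim_eq_0)
  qed
  then obtain N' where N': "N = add_mset \<mu> N'" by (metis multi_member_split)
  have "lambda_2 C = \<mu>"
  proof -
    have le: "\<mu> \<le> c" if "c \<in># N" for c
      by (rule Emin) (use N that in blast)
    have "sorted_list_of_multiset N = \<mu> # sorted_list_of_multiset N'"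
      using le by (simp add: N' insort_is_Cons)
    moreover have "sorted_list_of_multiset (add_mset 0 N) = 0 # sorted_list_of_multiset N"
      using order_trans[OF less_imp_le[OF pos] le] by (simp add: insort_is_Cons)
    ultimately show ?thesis unfolding lambda_2_def sorted_eigenvalues_def M by simp
  qed
  with pos ray show "0 < lambda_2 C" "\<And>w. 1 \<bullet> w = 0 \<Longrightarrow> lambda_2 C * (norm w)\<^sup>2 \<le> w \<bullet> (C *v w)"
    by auto
qed

text \<open>The rank-one term in \<open>T\<close> fills in the kernel of \<open>C\<close>, so
  \<open>T\<close> is injective and thus surjective; for right-hand sides orthogonal to 1 the added
  term vanishes.\<close>

lemma mult_surj_on_orthogonal_one:
  assumes "1 \<bullet> y = 0"
  obtains z where "1 \<bullet> z = 0" "C *v z = y"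
proof -
  define T where "T v = C *v v + (1 \<bullet> v) *\<^sub>R 1" for v
  have lin: "linear T"
    by (rule linearI) (simp_all add: T_def matrix_vector_right_distrib inner_add_right
        scaleR_add_left matrix_vector_mult_scaleR scaleR_add_right)
  have "inj T"
    unfolding linear_injective_0[OF lin]
  proof (intro allI impI)
    fix v assume T0: "T v = 0"
    have "v \<bullet> T v = v \<bullet> (C *v v) + (1 \<bullet> v)\<^sup>2"
      by (simp add: T_def inner_add_right power2_eq_square inner_commute)
    then have "v \<bullet> (C *v v) = 0" "1 \<bullet> v = 0"
      using T0 quadratic_form_nonneg[of v] zero_le_power2[of "1 \<bullet> v"]
      by (simp_all add: add_nonneg_eq_0_iff)
    then show "v = 0"
      using psd_null[OF C_sym quadratic_form_nonneg] null_orthogonal_one by blast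
  qed
  then obtain z where z: "T z = y"
    using linear_injective_imp_surjective[OF lin] by (metis surjD)
  have "1 \<bullet> T z = (1 \<bullet> z) * (1 \<bullet> (1 :: real^'m))"
    by (simp add: T_def inner_add_right one_inner_mult_vec)
  then have "1 \<bullet> z = 0" using z assms one_inner_one_pos[where 'n='m] by simp
  with z show thesis using that by (simp add: T_def)
qed

end

section \<open>The Frobenius inner product\<close>

text \<open>Left multiplication acts column by column, so this carries facts about quadratic forms
  from vectors to matrices.\<close>

lemma inner_eq_sum_columns:
  fixes X Y :: "real^'d^'m"
  shows "X \<bullet> Y = (\<Sum>j\<in>UNIV. column j X \<bullet> column j Y)"
  unfolding inner_vec_def column_def by (simp, rule sum.swap)

lemma norm_sq_eq_sum_columns:
  fixes X :: "real^'d^'m"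
  shows "(norm X)\<^sup>2 = (\<Sum>j\<in>UNIV. (norm (column j X))\<^sup>2)"
  using inner_eq_sum_columns[of X X] by (simp add: dot_square_norm)

lemma column_matrix_mult: "column j (A ** X) = A *v column j X"
  by (simp add: column_def matrix_matrix_mult_def matrix_vector_mult_def vec_eq_iff)

lemma symmetric_mat_inner_mult:
  fixes X Y :: "real^'d^'m"
  assumes "symmetric_mat A"
  shows "(A ** X) \<bullet> Y = X \<bullet> (A ** Y)"
  unfolding inner_eq_sum_columns column_matrix_mult
  using symmetric_mat_inner[OF assms] by simp

lemma loewner_le_inner_mult:
  fixes X :: "real^'d^'m"
  assumes "loewner_le A B"
  shows "X \<bullet> (A ** X) \<le> X \<bullet> (B ** X)"
  unfolding inner_eq_sum_columns column_matrix_mult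
  using assms
  by (intro sum_mono) (simp add: loewner_le_def matrix_vector_mult_diff_rdistrib inner_diff_right)

lemma lambda_min_le_inner_mult:
  fixes X :: "real^'d^'m"
  assumes "symmetric_mat A"
  shows "lambda_min A * (norm X)\<^sup>2 \<le> X \<bullet> (A ** X)"
  unfolding inner_eq_sum_columns[of X] column_matrix_mult norm_sq_eq_sum_columns sum_distrib_left
  using lambda_min_le[OF assms] by (intro sum_mono)

lemma sq_norm_wrt_eq_inner: "sq_norm_wrt D X = X \<bullet> (D ** X)"
  unfolding sq_norm_wrt_def matrix_mul_assoc[symmetric] inner_eq_sum_columns
  by (simp add: trace_def matrix_matrix_mult_def[of "transpose X"] inner_vec_def column_def)
    (simp add: transpose_def)

section \<open>Consensus matrices and the centering projection\<close>

lemma outer_one_nth [simp]: "outer 1 v $ i = v"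
  by (simp add: outer_def vec_eq_iff)

lemma outer_minus_right: "outer u (- v) = - outer u v"
  by (simp add: outer_def vec_eq_iff)

lemma outer_zero_left: "outer 0 v = 0"
  by (simp add: outer_def vec_eq_iff)

lemma inner_outer_one: "X \<bullet> outer 1 v = (\<Sum>i\<in>UNIV. X $ i) \<bullet> v"
  by (subst inner_vec_def) (simp add: inner_sum_left)

lemma one_inner_column: "1 \<bullet> column j X = (\<Sum>i\<in>UNIV. X $ i) $ j"
  by (simp add: inner_vec_def column_def)

lemma mult_outer_one: "A ** outer 1 v = outer (A *v 1) v"
  by (simp add: outer_def matrix_matrix_mult_def matrix_vector_mult_def vec_eq_iff sum_distrib_right)

lemma avg_mat_mult:
  fixes X :: "real^'d^'m"
  shows "avg_mat ** X = outer 1 ((1 / real CARD('m)) *\<^sub>R (\<Sum>i\<in>UNIV. X $ i))"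
  by (simp add: avg_mat_def outer_def matrix_matrix_mult_def vec_eq_iff sum_distrib_left)

lemma matrix_diff_rdistrib:
  fixes A B :: "real^'n^'m"
  shows "(A - B) ** X = A ** X - B ** X"
  by (simp add: matrix_matrix_mult_def vec_eq_iff left_diff_distrib sum_subtractf)

lemma centering_mult:
  fixes X :: "real^'d^'m"
  shows "(mat 1 - avg_mat) ** X = X - outer 1 ((1 / real CARD('m)) *\<^sub>R (\<Sum>i\<in>UNIV. X $ i))"
  by (simp add: matrix_diff_rdistrib avg_mat_mult)

lemma sum_rows_centering:
  fixes X :: "real^'d^'m"
  shows "(\<Sum>i\<in>UNIV. ((mat 1 - avg_mat) ** X) $ i) = 0"
  by (simp add: centering_mult sum_subtractf sum_constant_scaleR del: sum_constant)

text \<open>Centering subtracts a matrix with equal rows, and such a matrix is orthogonal to any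
  whose rows sum to zero.\<close>

lemma inner_centering:
  fixes X Y :: "real^'d^'m"
  assumes "(\<Sum>i\<in>UNIV. Y $ i) = 0"
  shows "Y \<bullet> ((mat 1 - avg_mat) ** X) = Y \<bullet> X"
  using assms by (simp add: centering_mult inner_diff_right inner_outer_one)

lemma norm_centering_le:
  fixes X :: "real^'d^'m"
  shows "norm ((mat 1 - avg_mat) ** X) \<le> norm X"
proof (rule norm_le[THEN iffD2])
  let ?P = "(mat 1 - avg_mat) ** X"
  have "?P \<bullet> ?P = ?P \<bullet> X" by (rule inner_centering[OF sum_rows_centering])
  also have "\<dots> \<le> norm ?P * norm X" by (rule norm_cauchy_schwarz)
  finally have "norm ?P \<le> norm X \<or> norm ?P = 0"
    by (auto simp: dot_square_norm power2_eq_square)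
  then have "norm ?P \<le> norm X" by auto
  then show "?P \<bullet> ?P \<le> X \<bullet> X" by (simp add: norm_le)
qed

text \<open>Stands in for a pseudoinverse estimate: columnwise preimages orthogonal to 1 obey the
  Rayleigh bound, which with Cauchy-Schwarz gives
  \<open>norm Z \<le> norm Y / lambda_2 C\<close>.\<close>

lemma mult_preimage_bound:
  fixes Y :: "real^'d^'m" and C :: "real^'m^'m"
  assumes m: "2 \<le> CARD('m)"
    and C: "symmetric_mat C" "loewner_le 0 C" "null_space C = span {1}"
    and Y: "(\<Sum>i\<in>UNIV. Y $ i) = 0"
  obtains Z where "C ** Z = Y" "Z \<bullet> Y \<le> (norm Y)\<^sup>2 / lambda_2 C"
proof -
  have "\<exists>z. 1 \<bullet> z = 0 \<and> C *v z = column j Y" for j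
    using mult_surj_on_orthogonal_one[OF C, of "column j Y"] Y by (metis one_inner_column zero_index)
  then obtain z where z: "\<And>j. 1 \<bullet> z j = 0" "\<And>j. C *v z j = column j Y" by metis
  define Z :: "real^'d^'m" where "Z = (\<chi> i j. z j $ i)"
  have col: "column j Z = z j" for j by (simp add: Z_def column_def vec_eq_iff)
  have CZ: "C ** Z = Y"
  proof -
    have "column j (C ** Z) = column j Y" for j by (simp add: column_matrix_mult col z)
    then show ?thesis by (simp add: column_def vec_eq_iff)
  qed
  have pos: "0 < lambda_2 C" by (rule lambda_2_Rayleigh(1)[OF C m])
  have "lambda_2 C * (norm Z)\<^sup>2 \<le> Z \<bullet> (C ** Z)"
    unfolding inner_eq_sum_columns[of Z] column_matrix_mult norm_sq_eq_sum_columns sum_distrib_left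
    by (intro sum_mono lambda_2_Rayleigh(2)[OF C m]) (simp add: col z)
  then have 1: "lambda_2 C * (norm Z)\<^sup>2 \<le> Z \<bullet> Y" by (simp add: CZ)
  have cs: "Z \<bullet> Y \<le> norm Z * norm Y" by (rule norm_cauchy_schwarz)
  have "lambda_2 C * norm Z \<le> norm Y"
  proof (cases "Z = 0")
    case False
    have "(lambda_2 C * norm Z) * norm Z \<le> norm Y * norm Z"
      using 1 cs by (simp add: power2_eq_square mult_ac)
    then show ?thesis using False by simp
  qed simp
  then have "norm Z \<le> norm Y / lambda_2 C" using pos by (simp add: field_simps)
  then have "norm Z * norm Y \<le> norm Y / lambda_2 C * norm Y" by (intro mult_right_mono) auto
  with cs have "Z \<bullet> Y \<le> (norm Y)\<^sup>2 / lambda_2 C" by (simp add: power2_eq_square)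
  with CZ show thesis using that by blast
qed

section \<open>Extended-real-valued convex functions and proximal points\<close>

definition effective_domain :: "('a \<Rightarrow> ereal) \<Rightarrow> 'a set" where
  "effective_domain G = {x. G x \<noteq> \<infinity>}"

text \<open>Allows real arithmetic; infinite values are sent to 0, so facts about it are confined to
  \<open>effective_domain G\<close>.\<close>

definition real_part :: "('a \<Rightarrow> ereal) \<Rightarrow> 'a \<Rightarrow> real" where
  "real_part G x = real_of_ereal (G x)"

lemma ereal_real_part:
  assumes "proper_fun G" "x \<in> effective_domain G"
  shows "G x = ereal (real_part G x)"
  using assms by (cases "G x") (auto simp: proper_fun_def effective_domain_def real_part_def)

text \<open>Convex combinations of graph points stay in the epigraph, which both bounds the value
  there and keeps it finite.\<close>

lemma convex_on_real_part:
  assumes "proper_fun G" "convex_fun G"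
  shows "convex_on (effective_domain G) (real_part G)"
proof -
  have step: "(1 - t) *\<^sub>R x + t *\<^sub>R y \<in> effective_domain G \<and>
      real_part G ((1 - t) *\<^sub>R x + t *\<^sub>R y) \<le> (1 - t) * real_part G x + t * real_part G y"
    if "x \<in> effective_domain G" "y \<in> effective_domain G" "0 \<le> t" "t \<le> 1" for x y t
  proof -
    have "(x, real_part G x) \<in> ereal_epigraph G" "(y, real_part G y) \<in> ereal_epigraph G"
      using that ereal_real_part[OF assms(1)] by (simp_all add: ereal_epigraph_def)
    then have "(1 - t) *\<^sub>R (x, real_part G x) + t *\<^sub>R (y, real_part G y) \<in> ereal_epigraph G"
      using assms(2) that unfolding convex_fun_def by (intro convexD) auto
    then have le: "G ((1 - t) *\<^sub>R x + t *\<^sub>R y)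
        \<le> ereal ((1 - t) * real_part G x + t * real_part G y)"
      by (simp add: ereal_epigraph_def)
    then have dom: "(1 - t) *\<^sub>R x + t *\<^sub>R y \<in> effective_domain G"
      by (auto simp: effective_domain_def)
    with le show ?thesis using ereal_real_part[OF assms(1) dom] by simp
  qed
  have "convex (effective_domain G)"
    unfolding convex_alt using step by blast
  then show ?thesis using step by (intro convex_onI) auto
qed

text \<open>An infinite value at \<open>x\<close> would force \<open>G\<close> to be infinite
  everywhere, against properness.\<close>

lemma subdifferential_real_part:
  assumes G: "proper_fun G" and \<xi>: "\<xi> \<in> subdifferential G x"
  shows "x \<in> effective_domain G"
    and "y \<in> effective_domain G \<Longrightarrow> real_part G x + \<xi> \<bullet> (y - x) \<le> real_part G y"
proof -
  have le: "G x + ereal (\<xi> \<bullet> (y - x)) \<le> G y" for y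
    using \<xi> by (simp add: subdifferential_def)
  obtain z where "G z \<noteq> \<infinity>" using G by (auto simp: proper_fun_def)
  with le[of z] show x: "x \<in> effective_domain G"
    by (auto simp: effective_domain_def)
  show "real_part G x + \<xi> \<bullet> (y - x) \<le> real_part G y" if "y \<in> effective_domain G"
    using le[of y] ereal_real_part[OF G that] ereal_real_part[OF G x] by simp
qed

lemma stack_reg_eq:
  assumes "proper_fun G"
  shows "stack_reg G X = (if \<forall>i. X $ i \<in> effective_domain G
    then ereal (\<Sum>i\<in>UNIV. real_part G (X $ i)) else \<infinity>)"
proof (cases "\<forall>i. X $ i \<in> effective_domain G")
  case True
  then have "stack_reg G X = (\<Sum>i\<in>UNIV. ereal (real_part G (X $ i)))"
    unfolding stack_reg_def using ereal_real_part[OF assms] by (intro sum.cong) auto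
  with True show ?thesis by (simp add: sum_ereal)
next
  case False
  then have "stack_reg G X = \<infinity>"
    unfolding stack_reg_def sum_Pinfty by (auto simp: effective_domain_def)
  with False show ?thesis by simp
qed

text \<open>Minimising \<open>t + a * (norm (x - y))\<^sup>2\<close> over the epigraph makes the objective continuous; the affine
  minorant given by the subgradient makes its sublevel sets bounded.\<close>

lemma proximal_point_exists:
  fixes G :: "'a::euclidean_space \<Rightarrow> ereal"
  assumes G: "proper_fun G" "closed_fun G" and \<xi>: "\<xi> \<in> subdifferential G z" and a: "0 < a"
  obtains p where "p \<in> effective_domain G"
    "\<And>y. y \<in> effective_domain G \<Longrightarrow>
      real_part G p + a * (norm (x - p))\<^sup>2 \<le> real_part G y + a * (norm (x - y))\<^sup>2"
proof -
  note sub = subdifferential_real_part[OF G(1) \<xi>]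
  define h where "h w = snd w + a * (norm (x - fst w))\<^sup>2" for w :: "'a \<times> real"
  define c where "c = h (z, real_part G z)"
  \<comment> \<open>The level \<open>c\<close> is attained at \<open>(z, real_part G z)\<close>, so
    \<open>K\<close> is nonempty and a minimiser over it is one over the whole epigraph.\<close>
  define K where "K = ereal_epigraph G \<inter> {w. h w \<le> c}"
  have epi: "(y, t) \<in> ereal_epigraph G \<longleftrightarrow> y \<in> effective_domain G \<and> real_part G y \<le> t" for y t
  proof (cases "y \<in> effective_domain G")
    case True then show ?thesis using ereal_real_part[OF G(1) True] by (simp add: ereal_epigraph_def)
  qed (auto simp: ereal_epigraph_def effective_domain_def)
  have cont: "continuous_on UNIV h" unfolding h_def by (intro continuous_intros)
  have "closed K"
    using G(2) unfolding K_def closed_fun_def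
    by (intro closed_Int closed_Collect_le cont continuous_on_const)
  moreover have "bounded K"
  proof -
    \<comment> \<open>For \<open>r = norm (x - y)\<close>, the affine minorant and the level
      \<open>c\<close> give \<open>a * r\<^sup>2 \<le> B + norm \<xi> * r\<close>. If
      \<open>r > 1\<close>, the right side is at most \<open>(B + norm \<xi>) * r\<close>, whence
      \<open>r \<le> R\<close>; \<open>l\<close> bounds the heights from below.\<close>
    define B where "B = a * (norm (x - z))\<^sup>2 + norm \<xi> * norm (x - z)"
    define R where "R = max 1 ((B + norm \<xi>) / a)"
    define l where "l = real_part G z - norm \<xi> * (norm (x - z) + R)"
    have "K \<subseteq> cball x R \<times> {l..c}"
    proof
      fix w assume w: "w \<in> K"
      obtain y t where yt: "w = (y, t)" by force
      from w have y: "y \<in> effective_domain G" and t: "real_part G y \<le> t" and hc: "h (y, t) \<le> c"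
        by (auto simp: yt K_def epi)
      have lo: "real_part G z - norm \<xi> * (norm (x - z) + norm (x - y)) \<le> t"
      proof -
        have "- (\<xi> \<bullet> (y - z)) \<le> norm \<xi> * norm (y - z)"
          using norm_cauchy_schwarz[of \<xi> "z - y"] by (simp add: inner_diff_right norm_minus_commute)
        also have "\<dots> \<le> norm \<xi> * (norm (x - z) + norm (x - y))"
          using norm_triangle_ineq4[of "x - z" "x - y"] by (intro mult_left_mono) auto
        finally show ?thesis using sub(2)[OF y] t by simp
      qed
      have up: "t + a * (norm (x - y))\<^sup>2 \<le> c" using hc by (simp add: h_def)
      have quad: "a * (norm (x - y))\<^sup>2 \<le> B + norm \<xi> * norm (x - y)"
        using lo up by (simp add: c_def h_def B_def algebra_simps)
      have R: "norm (x - y) \<le> R"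
      proof (cases "norm (x - y) \<le> 1")
        case False
        have "0 \<le> B" using a by (simp add: B_def)
        then have "B * 1 \<le> B * norm (x - y)" using False by (intro mult_left_mono) auto
        then have "(a * norm (x - y)) * norm (x - y) \<le> (B + norm \<xi>) * norm (x - y)"
          using quad by (simp add: power2_eq_square algebra_simps)
        then have "a * norm (x - y) \<le> B + norm \<xi>"
          by (rule mult_right_le_imp_le) (use False in linarith)
        then have "norm (x - y) \<le> (B + norm \<xi>) / a" using a by (simp add: pos_le_divide_eq mult.commute)
        then show ?thesis by (simp add: R_def)
      qed (simp add: R_def)
      have "norm \<xi> * (norm (x - z) + norm (x - y)) \<le> norm \<xi> * (norm (x - z) + R)"
        using R by (intro mult_left_mono) auto
      then have "l \<le> t" using lo by (simp add: l_def)
      moreover have "t \<le> c" using up a by (smt (verit) mult_nonneg_nonneg zero_le_power2)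
      ultimately show "w \<in> cball x R \<times> {l..c}" using R by (simp add: yt dist_norm)
    qed
    then show ?thesis
      by (rule bounded_subset[rotated]) (intro bounded_Times bounded_cball bounded_closed_interval)
  qed
  ultimately have "compact K" by (simp add: compact_eq_bounded_closed)
  moreover have zK: "(z, real_part G z) \<in> K"
    using sub(1) by (simp add: K_def epi c_def)
  ultimately obtain w where w: "w \<in> K" "\<And>v. v \<in> K \<Longrightarrow> h w \<le> h v"
    using continuous_attains_inf[of K h] continuous_on_subset[OF cont] by blast
  obtain p t where pt: "w = (p, t)" by force
  from w(1) have p: "p \<in> effective_domain G" "real_part G p \<le> t" "h (p, t) \<le> c"
    by (auto simp: pt K_def epi)
  show thesis
  proof (rule that[OF p(1)])
    fix y assume y: "y \<in> effective_domain G"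
    \<comment> \<open>Above the level \<open>c\<close> the claim is immediate, since
      \<open>h (p, t) \<le> c\<close>.\<close>
    have "h (p, t) \<le> h (y, real_part G y)"
    proof (cases "h (y, real_part G y) \<le> c")
      case True
      then show ?thesis using w(2)[of "(y, real_part G y)"] y by (simp add: K_def epi pt)
    qed (use p in simp)
    then show "real_part G p + a * (norm (x - p))\<^sup>2 \<le> real_part G y + a * (norm (x - y))\<^sup>2"
      using p(2) by (simp add: h_def)
  qed
qed

section \<open>The proximal step of the stacked regulariser\<close>

lemma norm_diff_scaleR_sq:
  fixes u v :: "'a::real_inner"
  shows "(norm (u - s *\<^sub>R v))\<^sup>2 = (norm u)\<^sup>2 - 2 * s * (u \<bullet> v) + s\<^sup>2 * (norm v)\<^sup>2"
  unfolding power2_norm_eq_inner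
  by (simp add: inner_diff_left inner_diff_right inner_commute power2_eq_square algebra_simps)

lemma norm_sq_eq_sum_rows:
  fixes X :: "real^'d^'m"
  shows "(norm X)\<^sup>2 = (\<Sum>i\<in>UNIV. (norm (X $ i))\<^sup>2)"
  by (simp only: power2_norm_eq_inner inner_vec_def[of X X])

text \<open>\<open>prox\<close> is a choice, so a minimiser must first be exhibited: the objective
  separates over rows, each of which has a proximal point. Comparing \<open>P\<close> with the
  segment towards \<open>Y\<close> then makes \<open>(1 / \<gamma>) *\<^sub>R (X - P)\<close> a
  subgradient at \<open>P\<close>.\<close>

lemma prox_stack_reg_variational:
  fixes G :: "real^'d \<Rightarrow> ereal" and X :: "real^'d^'m"
  assumes G: "proper_fun G" "closed_fun G" "convex_fun G"
    and \<xi>: "\<xi> \<in> subdifferential G z" and \<gamma>: "0 < \<gamma>"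
  defines "P \<equiv> prox \<gamma> (stack_reg G) X"
  shows "P $ i \<in> effective_domain G"
    and "(\<And>i. Y $ i \<in> effective_domain G) \<Longrightarrow>
      (\<Sum>i\<in>UNIV. real_part G (P $ i)) + (1 / \<gamma>) * ((X - P) \<bullet> (Y - P))
        \<le> (\<Sum>i\<in>UNIV. real_part G (Y $ i))"
proof -
  define a where "a = 1 / (2 * \<gamma>)"
  have a: "0 < a" using \<gamma> by (simp add: a_def)
  define g where "g Y = (\<Sum>i\<in>UNIV. real_part G (Y $ i))" for Y :: "real^'d^'m"
  define \<Phi> where "\<Phi> Y = stack_reg G Y + ereal (a * (norm (X - Y))\<^sup>2)" for Y
  let ?dom = "\<lambda>Y :: real^'d^'m. \<forall>i. Y $ i \<in> effective_domain G"
  have \<Phi>: "\<Phi> Y = (if ?dom Y then ereal (g Y + a * (norm (X - Y))\<^sup>2) else \<infinity>)" for Y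
    by (simp add: \<Phi>_def stack_reg_eq[OF G(1)] g_def)
  have "\<exists>p. p \<in> effective_domain G \<and> (\<forall>y \<in> effective_domain G.
      real_part G p + a * (norm (X $ i - p))\<^sup>2 \<le> real_part G y + a * (norm (X $ i - y))\<^sup>2)" for i
    using proximal_point_exists[OF G(1,2) \<xi> a] by metis
  then obtain p where p: "\<And>i. p i \<in> effective_domain G"
    "\<And>i y. y \<in> effective_domain G \<Longrightarrow>
      real_part G (p i) + a * (norm (X $ i - p i))\<^sup>2 \<le> real_part G y + a * (norm (X $ i - y))\<^sup>2"
    by metis
  have split: "g Y + a * (norm (X - Y))\<^sup>2
      = (\<Sum>i\<in>UNIV. real_part G (Y $ i) + a * (norm (X $ i - Y $ i))\<^sup>2)" for Y
    by (simp add: g_def norm_sq_eq_sum_rows sum.distrib sum_distrib_left)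
  have "is_arg_min \<Phi> (\<lambda>_. True) (\<chi> i. p i)"
    unfolding is_arg_min_def \<Phi> split using p by (auto simp: not_less intro!: sum_mono)
  then have P: "is_arg_min \<Phi> (\<lambda>_. True) P"
    unfolding P_def prox_def arg_min_def \<Phi>_def[abs_def] a_def[symmetric] by (rule someI)
  then have Pmin: "\<Phi> P \<le> \<Phi> Y" for Y
    by (simp add: is_arg_min_def not_less)
  have domP: "?dom P"
  proof (rule ccontr)
    assume "\<not> ?dom P"
    then have "\<Phi> P = \<infinity>" by (simp add: \<Phi>)
    with Pmin[of "\<chi> i. p i"] p(1) show False by (simp add: \<Phi>)
  qed
  then show "P $ i \<in> effective_domain G" by blast
  note conv = convex_on_real_part[OF G(1,3)]
  assume domY: "\<And>i. Y $ i \<in> effective_domain G"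
  \<comment> \<open>At the point \<open>W\<close> of the segment, convexity bounds the change of
    \<open>g\<close> linearly in \<open>s\<close>, while the squared norm adds an
    \<open>s\<^sup>2\<close> term.\<close>
  have "0 \<le> s * (g Y - g P - (1 / \<gamma>) * ((X - P) \<bullet> (Y - P))) + s\<^sup>2 * (a * (norm (Y - P))\<^sup>2)"
    if s: "0 < s" "s \<le> 1" for s
  proof -
    define W where "W = (1 - s) *\<^sub>R P + s *\<^sub>R Y"
    have domW: "?dom W"
      using convexD_alt[OF convex_on_imp_convex[OF conv]] domP domY s by (simp add: W_def)
    have "g W \<le> (\<Sum>i\<in>UNIV. (1 - s) * real_part G (P $ i) + s * real_part G (Y $ i))"
      unfolding g_def W_def using convex_onD[OF conv] domP domY s by (intro sum_mono) simp
    also have "\<dots> = (1 - s) * g P + s * g Y"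
      by (simp add: g_def sum.distrib sum_distrib_left)
    finally have gW: "g W \<le> (1 - s) * g P + s * g Y" .
    have "g P + a * (norm (X - P))\<^sup>2 \<le> g W + a * (norm (X - W))\<^sup>2"
      using Pmin[of W] domP domW by (simp add: \<Phi>)
    moreover have "(norm (X - W))\<^sup>2
        = (norm (X - P))\<^sup>2 - 2 * s * ((X - P) \<bullet> (Y - P)) + s\<^sup>2 * (norm (Y - P))\<^sup>2"
    proof -
      have XW: "X - W = (X - P) - s *\<^sub>R (Y - P)" by (simp add: W_def algebra_simps)
      show ?thesis
        using norm_diff_scaleR_sq[of "X - P" s "Y - P"] by (simp only: XW)
    qed
    ultimately have "0 \<le> s * (g Y - g P) + a * (- 2 * s * ((X - P) \<bullet> (Y - P)) + s\<^sup>2 * (norm (Y - P))\<^sup>2)"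
      using gW by (simp add: algebra_simps)
    also have "\<dots> = s * (g Y - g P - (1 / \<gamma>) * ((X - P) \<bullet> (Y - P))) + s\<^sup>2 * (a * (norm (Y - P))\<^sup>2)"
      using \<gamma> by (simp add: a_def field_simps)
    finally show ?thesis .
  qed
  then have "0 \<le> g Y - g P - (1 / \<gamma>) * ((X - P) \<bullet> (Y - P))"
    by (rule nonneg_if_quadratic_nonneg)
  then show "(\<Sum>i\<in>UNIV. real_part G (P $ i)) + (1 / \<gamma>) * ((X - P) \<bullet> (Y - P))
        \<le> (\<Sum>i\<in>UNIV. real_part G (Y $ i))"
    by (simp add: g_def)
qed

section \<open>The primal-dual estimate\<close>

text \<open>The dual variable is carried as \<open>C z\<close>, so that \<open>(w - z) \<bullet> C (w - z)\<close> plays the role of the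
  squared distance of \<open>C w\<close> and \<open>C z\<close> in the norm of the pseudoinverse of \<open>C\<close>. The quadratic term in \<open>C p\<close>
  lost by the primal step is exactly the one gained by the dual step.\<close>

lemma primal_dual_step:
  fixes C D :: "'a::real_inner \<Rightarrow> 'a"
    and w :: 'a
  assumes lin: "linear C" "linear D"
    and sym: "\<And>u v. C u \<bullet> v = u \<bullet> C v" "\<And>u v. D u \<bullet> v = u \<bullet> D v"
    and fix_xs: "D xs = xs" "C xs = 0"
    and upper: "\<And>u. u \<bullet> D u + u \<bullet> C u / 2 \<le> u \<bullet> u"
    and lower: "\<And>u. \<gamma> * L * (norm u)\<^sup>2 \<le> u \<bullet> D u"
    and \<gamma>: "0 < \<gamma>"
    and descent: "r \<le> L / 2 * (norm (p - x))\<^sup>2 + (1 / \<gamma>) * ((D x - p) \<bullet> (p - xs)) - C z \<bullet> (p - xs)"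
  defines "V \<equiv> \<lambda>x z. 1 / (2 * \<gamma>) * ((x - xs) \<bullet> D (x - xs)) + \<gamma> / 2 * ((w - z) \<bullet> C (w - z))"
  shows "r + C w \<bullet> p \<le> V x z - V p (z + (1 / \<gamma>) *\<^sub>R p)"
proof -
  define e where "e = x - xs"
  define e' where "e' = p - xs"
  have x: "x = xs + e" and p: "p = xs + e'" by (simp_all add: e_def e'_def)
  note linC = linear_add[OF lin(1)] linear_diff[OF lin(1)] linear_scale[OF lin(1)]
  note linD = linear_add[OF lin(2)] linear_diff[OF lin(2)] linear_scale[OF lin(2)]
  have Cp: "C p = C e'" by (simp add: p linC fix_xs)
  have "(D x - p) \<bullet> e' = D e \<bullet> e' - e' \<bullet> e'"
    by (simp add: x p linD fix_xs inner_diff_left)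
  \<comment> \<open>\<open>upper\<close> trades the full square for the \<open>D\<close> form and
    half the \<open>C\<close> form; the latter pays for the dual step.\<close>
  also have "\<dots> \<le> D e \<bullet> e' - e' \<bullet> D e' - e' \<bullet> C e' / 2"
    using upper[of e'] by simp
  \<comment> \<open>Three-point identity for the symmetric form of \<open>D\<close>.\<close>
  also have "D e \<bullet> e' - e' \<bullet> D e' = (e \<bullet> D e - e' \<bullet> D e' - (e' - e) \<bullet> D (e' - e)) / 2"
    using sym(2)[of e e'] by (simp add: linD inner_diff_left inner_diff_right inner_commute)
  \<comment> \<open>Since \<open>e' - e = p - x\<close>, this term, once divided by
    \<open>\<gamma>\<close>, cancels the \<open>L / 2\<close> term of
    \<open>descent\<close>.\<close>
  also have "(e \<bullet> D e - e' \<bullet> D e' - (e' - e) \<bullet> D (e' - e)) / 2 - e' \<bullet> C e' / 2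
      \<le> (e \<bullet> D e - e' \<bullet> D e' - \<gamma> * L * (norm (e' - e))\<^sup>2) / 2 - e' \<bullet> C e' / 2"
    by (intro diff_right_mono divide_right_mono diff_left_mono lower) auto
  finally have "(D x - p) \<bullet> e'
      \<le> (e \<bullet> D e - e' \<bullet> D e' - \<gamma> * L * (norm (e' - e))\<^sup>2) / 2 - e' \<bullet> C e' / 2" .
  then have "(1 / \<gamma>) * ((D x - p) \<bullet> e')
      \<le> (1 / \<gamma>) * ((e \<bullet> D e - e' \<bullet> D e' - \<gamma> * L * (norm (e' - e))\<^sup>2) / 2 - e' \<bullet> C e' / 2)"
    using \<gamma> by (intro mult_left_mono) auto
  also have "\<dots> = 1 / (2 * \<gamma>) * (e \<bullet> D e) - 1 / (2 * \<gamma>) * (e' \<bullet> D e')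
      - L / 2 * (norm (e' - e))\<^sup>2 - 1 / (2 * \<gamma>) * (e' \<bullet> C e')"
    using \<gamma> by (simp add: field_simps)
  finally have primal: "r \<le> 1 / (2 * \<gamma>) * (e \<bullet> D e) - 1 / (2 * \<gamma>) * (e' \<bullet> D e')
      - 1 / (2 * \<gamma>) * (e' \<bullet> C e') - C z \<bullet> e'"
    using descent by (simp add: e_def e'_def)
  have "xs \<bullet> C e' = 0" "C z \<bullet> xs = 0"
    using sym(1)[of xs e'] sym(1)[of z xs] by (simp_all add: fix_xs)
  then have Ce': "e' \<bullet> C e' = p \<bullet> C p" "C z \<bullet> e' = C z \<bullet> p"
    unfolding Cp by (simp_all add: p inner_add_left inner_add_right)
  \<comment> \<open>At \<open>s = 1 / \<gamma>\<close>, weighted by \<open>\<gamma> / 2\<close>, the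
    last term is the quadratic loss of \<open>primal\<close>.\<close>
  have "(a - s *\<^sub>R p) \<bullet> C (a - s *\<^sub>R p) = a \<bullet> C a - 2 * s * (C a \<bullet> p) + s\<^sup>2 * (p \<bullet> C p)" for a s
    using sym(1)[of a p] unfolding linC
    by (simp add: inner_diff_left inner_diff_right inner_commute power2_eq_square algebra_simps)
  from this[of "w - z" "1 / \<gamma>"]
  have "\<gamma> / 2 * ((w - (z + (1 / \<gamma>) *\<^sub>R p)) \<bullet> C (w - (z + (1 / \<gamma>) *\<^sub>R p)))
      = \<gamma> / 2 * ((w - z) \<bullet> C (w - z)) - C (w - z) \<bullet> p + 1 / (2 * \<gamma>) * (p \<bullet> C p)"
    using \<gamma> by (simp only: diff_diff_eq) (simp add: field_simps power2_eq_square)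
  moreover have "C (w - z) \<bullet> p = C w \<bullet> p - C z \<bullet> p"
    by (simp add: linC inner_diff_left)
  ultimately show ?thesis
    using primal[unfolded Ce'] unfolding V_def e_def[symmetric] e'_def[symmetric] by linarith
qed

lemma stack_fun_gradient_le:
  assumes "\<And>i. convex_on UNIV (f i)" "\<And>i x. f i differentiable (at x)"
  shows "stack_fun f X + stack_gradient f X \<bullet> (Y - X) \<le> stack_fun f Y"
  unfolding stack_fun_def inner_vec_def[of "stack_gradient f X"] sum.distrib[symmetric]
  using convex_on_gradient_le[OF assms] by (intro sum_mono) (simp add: stack_gradient_def)

lemma stack_fun_descent:
  assumes "\<And>i. L_smooth L (f i)"
  shows "stack_fun f Y \<le> stack_fun f X + stack_gradient f X \<bullet> (Y - X) + L / 2 * (norm (Y - X))\<^sup>2"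
  unfolding stack_fun_def inner_vec_def[of "stack_gradient f X"] norm_sq_eq_sum_rows
    sum_distrib_left sum.distrib[symmetric]
  using L_smooth_descent[OF assms] by (intro sum_mono) (simp add: stack_gradient_def)

lemma convex_on_average:
  fixes x :: "nat \<Rightarrow> 'a::real_vector"
  assumes "convex_on S f" "1 \<le> k" "\<And>t. t \<in> {1..k} \<Longrightarrow> x t \<in> S"
  shows "(1 / real k) *\<^sub>R (\<Sum>t=1..k. x t) \<in> S"
    and "f ((1 / real k) *\<^sub>R (\<Sum>t=1..k. x t)) \<le> (1 / real k) * (\<Sum>t=1..k. f (x t))"
proof -
  have "(\<Sum>t=1..k. (1 / real k) *\<^sub>R x t) \<in> S"
    using assms convex_on_imp_convex[OF assms(1)] by (intro convex_sum) auto
  then show "(1 / real k) *\<^sub>R (\<Sum>t=1..k. x t) \<in> S"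
    by (simp only: scaleR_sum_right)
  have "f (\<Sum>t=1..k. (1 / real k) *\<^sub>R x t) \<le> (\<Sum>t=1..k. (1 / real k) * f (x t))"
    using assms by (intro convex_on_sum) auto
  then show "f ((1 / real k) *\<^sub>R (\<Sum>t=1..k. x t)) \<le> (1 / real k) * (\<Sum>t=1..k. f (x t))"
    by (simp only: scaleR_sum_right sum_distrib_left)
qed

lemma linear_matrix_mult: "linear (\<lambda>X :: real^'d^'n. (A :: real^'n^'m) ** X)"
proof (rule linearI)
  show "A ** (c *\<^sub>R X) = c *\<^sub>R (A ** X)" for c and X :: "real^'d^'n"
    by (simp add: matrix_matrix_mult_def vec_eq_iff sum_distrib_left mult_ac)
qed (rule matrix_add_ldistrib)

lemma scaleR_matrix_mult: "(c *\<^sub>R A) ** X = c *\<^sub>R (A ** X)"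
  for A :: "real^'n^'m"
  by (simp add: matrix_matrix_mult_def vec_eq_iff sum_distrib_left mult_ac)

section \<open>Ergodic convergence rate\<close>

theorem theorem27:
  fixes f :: "'m::finite \<Rightarrow> real^'d \<Rightarrow> real"
    and G :: "real^'d \<Rightarrow> ereal"
    and L \<gamma> :: real
    and xs \<xi>s :: "real^'d"
    and Xs Ys :: "real^'d^'m"
    and C D :: "real^'m^'m"
    and X Xu Yu :: "nat \<Rightarrow> real^'d^'m"
  assumes m: "2 \<le> CARD('m)"
    and L: "0 < L"
    and f_convex: "\<And>i. convex_on UNIV (f i)"
    and f_smooth: "\<And>i. L_smooth L (f i)"
    and G_proper: "proper_fun G"
    and G_closed: "closed_fun G"
    and G_convex: "convex_fun G"
    and xs_opt: "is_arg_min (\<lambda>x. ereal (avg_fun f x) + G x) (\<lambda>_. True) xs"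
    and Xs: "Xs = outer 1 xs"
    and C_sym: "symmetric_mat C"
    and D_sym: "symmetric_mat D"
    and D_sum: "1 \<bullet> (D *v 1) = real CARD('m)"
    and C_psd: "loewner_le 0 C"
    and C_null: "null_space C = span {1}"
    and D_pos: "loewner_less 0 D"
    and D_le: "loewner_le D (mat 1 - (1 / 2) *\<^sub>R C)"
    and Y0: "Yu 0 = 0"
    and Xu_step: "\<And>k. Xu (Suc k) = D ** X k - \<gamma> *\<^sub>R (stack_gradient f (X k) + Yu k)"
    and X_step: "\<And>k. X (Suc k) = prox \<gamma> (stack_reg G) (Xu (Suc k))"
    and Y_step: "\<And>k. Yu (Suc k) = Yu k + (1 / \<gamma>) *\<^sub>R (C ** X (Suc k))"
    and \<gamma>_pos: "0 < \<gamma>"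
    and \<gamma>_less: "\<gamma> < lambda_min D / L"
    and \<xi>s_sub: "\<xi>s \<in> subdifferential G xs"
    and \<xi>s_opt: "\<xi>s + gradient (avg_fun f) xs = 0"
    and Ys: "Ys = - (stack_gradient f Xs + outer 1 \<xi>s)"
  shows "\<forall>k\<ge>1. merit f G Xs Ys ((1 / real k) *\<^sub>R (\<Sum>t=1..k. X t))
           \<le> ereal ((1 / real k) * (1 / (2 * \<gamma>) * sq_norm_wrt D (X 0 - Xs)
                + 2 * \<gamma> * (1 / lambda_2 C) * (norm (stack_gradient f Xs))\<^sup>2))"
proof (intro allI impI)
  fix k :: nat assume k: "1 \<le> k"
  note C = C_sym C_psd C_null
  define g where "g X = (\<Sum>i\<in>UNIV. real_part G (X $ i))" for X :: "real^'d^'m"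
  define h where "h X = stack_fun f X + g X" for X
  define P where "P X = (mat 1 - avg_mat) ** X" for X :: "real^'d^'m"
  define Xh where "Xh = (1 / real k) *\<^sub>R (\<Sum>t=1..k. X t)"
  have diff: "f i differentiable (at x)" for i x
    using f_smooth by (auto simp: L_smooth_def)
  note sub = subdifferential_real_part[OF G_proper \<xi>s_sub]
  note conv = convex_on_real_part[OF G_proper G_convex]
  have domX: "X t $ i \<in> effective_domain G" if t: "1 \<le> t" for t i
  proof -
    obtain s where "t = Suc s" using t by (metis Suc_le_D One_nat_def)
    then show ?thesis
      using prox_stack_reg_variational(1)[OF G_proper G_closed G_convex \<xi>s_sub \<gamma>_pos] X_step by simp
  qed
  have Xs_nth: "Xs $ i = xs" for i by (simp add: Xs)

  \<comment> \<open>The form of \<open>B = I - C / 2 - D\<close> is nonnegative and vanishes at 1 by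
    \<open>D_sum\<close> and \<open>C *v 1 = 0\<close>, so 1 is in its kernel. Consequently
    \<open>D\<close> fixes consensus matrices.\<close>
  have D1: "D *v 1 = 1"
  proof -
    define B where "B = mat 1 - (1 / 2) *\<^sub>R C - D"
    have B: "B *v v = v - (1 / 2) *\<^sub>R (C *v v) - D *v v" for v
      by (simp add: B_def matrix_vector_mult_diff_rdistrib scaleR_matrix_vector_assoc[symmetric])
    have "symmetric_mat B"
      using C_sym D_sym unfolding symmetric_mat_def B_def
      by (simp add: vec_eq_iff transpose_def mat_def)
    moreover have "0 \<le> v \<bullet> (B *v v)" for v
      using D_le by (simp add: loewner_le_def B_def)
    moreover have "1 \<bullet> (B *v 1) = 0"
      using D_sum mult_vec_one[OF C] by (simp add: B inner_diff_right inner_vec_def[of 1 1])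
    ultimately have "B *v 1 = 0" by (rule psd_null)
    then show ?thesis by (simp add: B mult_vec_one[OF C])
  qed

  \<comment> \<open>\<open>Y\<close> is the dual test point. Its factor 2 exceeds the factor 1 of
    the saddle-point bound, leaving one copy of the consensus term; squared, it is the 4 that
    becomes \<open>2 * \<gamma>\<close> in the rate.\<close>
  obtain Y W where Y: "Y \<bullet> Xh = 2 * (norm Ys * norm (P Xh))"
    and W: "C ** W = Y" "W \<bullet> Y \<le> 4 * (norm (stack_gradient f Xs))\<^sup>2 / lambda_2 C"
    and Ys_P: "Ys = - P (stack_gradient f Xs)"
  proof -
    \<comment> \<open>The mean row of the stacked gradient is \<open>- \<xi>s\<close>, so adding
      \<open>\<xi>s\<close> to every row is centering.\<close>
    have "(1 / real CARD('m)) *\<^sub>R (\<Sum>i\<in>UNIV. stack_gradient f Xs $ i) = - \<xi>s"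
      using \<xi>s_opt gradient_avg_fun[of f xs, OF diff]
      by (simp add: stack_gradient_def Xs_nth minus_unique)
    then have Ys_P: "Ys = - P (stack_gradient f Xs)"
      by (simp add: Ys P_def centering_mult outer_minus_right)
    have Ys_le: "norm Ys \<le> norm (stack_gradient f Xs)"
      by (simp add: Ys_P P_def norm_centering_le)
    \<comment> \<open>If \<open>P Xh = 0\<close>, division by zero yields \<open>Y = 0\<close>, and
      the claims below still hold.\<close>
    define Y where "Y = (2 * norm Ys / norm (P Xh)) *\<^sub>R P Xh"
    have "(\<Sum>i\<in>UNIV. Y $ i) = (2 * norm Ys / norm (P Xh)) *\<^sub>R (\<Sum>i\<in>UNIV. P Xh $ i)"
      by (simp only: Y_def vector_scaleR_component scaleR_sum_right)
    then have Y0: "(\<Sum>i\<in>UNIV. Y $ i) = 0"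
      by (simp add: P_def sum_rows_centering)
    have "Y \<bullet> Xh = Y \<bullet> P Xh" using inner_centering[OF Y0] by (simp add: P_def)
    also have "\<dots> = 2 * (norm Ys * norm (P Xh))"
      by (simp add: Y_def dot_square_norm power2_eq_square)
    finally have YXh: "Y \<bullet> Xh = 2 * (norm Ys * norm (P Xh))" .
    have "norm Y \<le> 2 * norm (stack_gradient f Xs)" using Ys_le by (simp add: Y_def)
    then have "(norm Y)\<^sup>2 \<le> (2 * norm (stack_gradient f Xs))\<^sup>2" by (intro power_mono) auto
    then have Y_le: "(norm Y)\<^sup>2 / lambda_2 C \<le> 4 * (norm (stack_gradient f Xs))\<^sup>2 / lambda_2 C"
      using lambda_2_Rayleigh(1)[OF C m] by (intro divide_right_mono) (auto simp: power_mult_distrib)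
    obtain W where "C ** W = Y" "W \<bullet> Y \<le> (norm Y)\<^sup>2 / lambda_2 C"
      using mult_preimage_bound[OF m C Y0] .
    with Y_le YXh Ys_P show thesis using that by fastforce
  qed

  \<comment> \<open>Lyapunov decrease along the iterates\<close>
  define Z where "Z j = (\<Sum>t=1..j. (1 / \<gamma>) *\<^sub>R X t)" for j
  \<comment> \<open>The empty sum \<open>Z 0 = 0\<close> matches the zero dual start.\<close>
  have Yu: "Yu j = C ** Z j" for j
  proof (induction j)
    case 0 show ?case by (simp add: Y0 Z_def matrix_matrix_mult_def vec_eq_iff)
  next
    case (Suc j)
    then show ?case
      by (simp add: Y_step Z_def linear_add[OF linear_matrix_mult] linear_scale[OF linear_matrix_mult])
  qed
  define V where "V x z = 1 / (2 * \<gamma>) * ((x - Xs) \<bullet> (D ** (x - Xs)))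
      + \<gamma> / 2 * ((W - z) \<bullet> (C ** (W - z)))" for x z
  have step: "h (X (Suc j)) - h Xs + Y \<bullet> X (Suc j) \<le> V (X j) (Z j) - V (X (Suc j)) (Z (Suc j))" for j
  proof -
    have Z_Suc: "Z (Suc j) = Z j + (1 / \<gamma>) *\<^sub>R X (Suc j)" by (simp add: Z_def)
    let ?p = "X (Suc j)"
    \<comment> \<open>The proximal inequality is tested at \<open>Xs\<close>, whose rows lie in the
      effective domain by \<open>sub(1)\<close>.\<close>
    have "g ?p + (1 / \<gamma>) * ((Xu (Suc j) - ?p) \<bullet> (Xs - ?p)) \<le> g Xs"
      using prox_stack_reg_variational(2)[OF G_proper G_closed G_convex \<xi>s_sub \<gamma>_pos,
          of Xs "Xu (Suc j)"] sub(1)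
      by (simp add: X_step g_def Xs_nth)
    moreover have "(1 / \<gamma>) * ((Xu (Suc j) - ?p) \<bullet> (Xs - ?p))
        = - (1 / \<gamma>) * ((D ** X j - ?p) \<bullet> (?p - Xs))
          + (stack_gradient f (X j) + C ** Z j) \<bullet> (?p - Xs)"
      using \<gamma>_pos by (simp add: Xu_step Yu inner_diff_left inner_diff_right inner_add_left field_simps)
    \<comment> \<open>The descent lemma from \<open>X j\<close> to the new iterate, combined with
      convexity from \<open>X j\<close> to \<open>Xs\<close>; both use the gradient at
      \<open>X j\<close>, the one in the update.\<close>
    moreover have "stack_fun f ?p \<le> stack_fun f Xs + stack_gradient f (X j) \<bullet> (?p - Xs)
        + L / 2 * (norm (?p - X j))\<^sup>2"
      using stack_fun_descent[of L f ?p "X j", OF f_smooth]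
        stack_fun_gradient_le[of f "X j" Xs, OF f_convex diff]
      by (simp add: inner_diff_right)
    ultimately have descent: "h ?p - h Xs \<le> L / 2 * (norm (?p - X j))\<^sup>2
        + (1 / \<gamma>) * ((D ** X j - ?p) \<bullet> (?p - Xs)) - (C ** Z j) \<bullet> (?p - Xs)"
      by (simp add: h_def inner_add_left)
    have fixes_Xs: "D ** Xs = Xs" "C ** Xs = 0"
      by (simp_all add: Xs mult_outer_one D1 mult_vec_one[OF C] outer_zero_left)
    have upper: "U \<bullet> (D ** U) + U \<bullet> (C ** U) / 2 \<le> U \<bullet> U" for U :: "real^'d^'m"
      using loewner_le_inner_mult[OF D_le, of U]
      by (simp add: matrix_diff_rdistrib scaleR_matrix_mult inner_diff_right)
    have lower: "\<gamma> * L * (norm U)\<^sup>2 \<le> U \<bullet> (D ** U)" for U :: "real^'d^'m"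
    proof -
      have "\<gamma> * L \<le> lambda_min D" using \<gamma>_less L by (simp add: field_simps)
      then have "\<gamma> * L * (norm U)\<^sup>2 \<le> lambda_min D * (norm U)\<^sup>2" by (intro mult_right_mono) auto
      also have "\<dots> \<le> U \<bullet> (D ** U)" by (rule lambda_min_le_inner_mult[OF D_sym])
      finally show ?thesis .
    qed
    show ?thesis
      unfolding V_def Z_Suc W(1)[symmetric]
      by (rule primal_dual_step[OF linear_matrix_mult linear_matrix_mult
            symmetric_mat_inner_mult[OF C_sym] symmetric_mat_inner_mult[OF D_sym]
            fixes_Xs upper lower \<gamma>_pos descent])
  qed
  \<comment> \<open>The decreases telescope; nonnegativity of \<open>V\<close> then removes the
    final value.\<close>
  have "(\<Sum>t=1..j. h (X t) - h Xs + Y \<bullet> X t) \<le> V (X 0) (Z 0) - V (X j) (Z j)" for j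
  proof (induction j)
    case (Suc j) then show ?case using step[of j] by simp
  qed simp
  moreover have "0 \<le> V x z" for x z
  proof -
    have "0 < lambda_min D" using less_trans[OF \<gamma>_pos \<gamma>_less] L by (simp add: zero_less_divide_iff)
    then have "0 \<le> (x - Xs) \<bullet> (D ** (x - Xs))"
      by (intro order_trans[OF _ lambda_min_le_inner_mult[OF D_sym]]) simp
    moreover have "(0 :: real^'m^'m) ** (W - z) = 0"
      by (simp add: matrix_matrix_mult_def vec_eq_iff)
    then have "0 \<le> (W - z) \<bullet> (C ** (W - z))"
      using loewner_le_inner_mult[OF C_psd, of "W - z"] by simp
    ultimately show ?thesis using \<gamma>_pos by (simp add: V_def)
  qed
  ultimately have sum_le: "(\<Sum>t=1..k. h (X t) - h Xs + Y \<bullet> X t) \<le> V (X 0) (Z 0)"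
    by (smt (verit))

  \<comment> \<open>The constant in the rate\<close>
  define R where "R = (1 / real k) * (1 / (2 * \<gamma>) * sq_norm_wrt D (X 0 - Xs)
                + 2 * \<gamma> * (1 / lambda_2 C) * (norm (stack_gradient f Xs))\<^sup>2)"
  \<comment> \<open>As \<open>Z 0 = 0\<close>, the dual part of \<open>V\<close> is
    \<open>\<gamma> / 2\<close> times \<open>W \<bullet> Y\<close>.\<close>
  have "V (X 0) (Z 0) \<le> 1 / (2 * \<gamma>) * sq_norm_wrt D (X 0 - Xs)
      + \<gamma> / 2 * (4 * (norm (stack_gradient f Xs))\<^sup>2 / lambda_2 C)"
    using mult_left_mono[OF W(2), of "\<gamma> / 2"] \<gamma>_pos
    by (simp add: V_def Z_def sq_norm_wrt_eq_inner W(1) del: times_divide_eq_left times_divide_eq_right)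
  also have "\<dots> = 1 / (2 * \<gamma>) * sq_norm_wrt D (X 0 - Xs)
                + 2 * \<gamma> * (1 / lambda_2 C) * (norm (stack_gradient f Xs))\<^sup>2"
    by simp
  finally have VR: "(1 / real k) * V (X 0) (Z 0) \<le> R"
    unfolding R_def by (intro mult_left_mono) auto

  \<comment> \<open>Jensen's inequality, row by row, at the ergodic average\<close>
  have Xh_nth: "Xh $ i = (1 / real k) *\<^sub>R (\<Sum>t=1..k. X t $ i)" for i
    by (simp add: Xh_def)
  have domXh: "Xh $ i \<in> effective_domain G" for i
    unfolding Xh_nth using convex_on_average(1)[OF conv k, of "\<lambda>t. X t $ i"] domX by simp
  have "g Xh \<le> (\<Sum>i\<in>UNIV. (1 / real k) * (\<Sum>t=1..k. real_part G (X t $ i)))"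
    unfolding g_def Xh_nth using domX by (intro sum_mono convex_on_average(2)[OF conv k]) simp
  also have "\<dots> = (1 / real k) * (\<Sum>t=1..k. g (X t))"
    unfolding g_def sum_distrib_left[symmetric] by (subst sum.swap) simp
  finally have gXh: "g Xh \<le> (1 / real k) * (\<Sum>t=1..k. g (X t))" .
  have "stack_fun f Xh \<le> (\<Sum>i\<in>UNIV. (1 / real k) * (\<Sum>t=1..k. f i (X t $ i)))"
    unfolding stack_fun_def Xh_nth by (intro sum_mono convex_on_average(2)[OF f_convex k]) simp
  also have "\<dots> = (1 / real k) * (\<Sum>t=1..k. stack_fun f (X t))"
    unfolding stack_fun_def sum_distrib_left[symmetric] by (subst sum.swap) simp
  finally have hXh: "h Xh \<le> (1 / real k) * (\<Sum>t=1..k. h (X t))"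
    using gXh by (simp add: h_def sum.distrib algebra_simps)

  have YXh: "Y \<bullet> Xh = (1 / real k) * (\<Sum>t=1..k. Y \<bullet> X t)"
    by (simp add: Xh_def inner_sum_right)
  have "h Xh - h Xs + Y \<bullet> Xh \<le> (1 / real k) * (\<Sum>t=1..k. h (X t) - h Xs + Y \<bullet> X t)"
    using hXh k unfolding YXh by (simp add: sum.distrib sum_subtractf algebra_simps)
  also have "\<dots> \<le> (1 / real k) * V (X 0) (Z 0)"
    using sum_le by (intro mult_left_mono) auto
  finally have upper: "h Xh - h Xs + 2 * (norm Ys * norm (P Xh)) \<le> R"
    using VR Y by simp

  \<comment> \<open>The subgradient and gradient inequalities at \<open>Xs\<close> add up to slope
    \<open>- Ys\<close>. Since the rows of \<open>Ys\<close> sum to zero, only the consensus error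
    \<open>P Xh\<close> is seen.\<close>
  have lower: "- (norm Ys * norm (P Xh)) \<le> h Xh - h Xs"
  proof -
    have Ys0: "(\<Sum>i\<in>UNIV. Ys $ i) = 0"
      by (simp add: Ys_P P_def sum_negf sum_rows_centering)
    have "g Xs + outer 1 \<xi>s \<bullet> (Xh - Xs) \<le> g Xh"
      unfolding g_def inner_vec_def[of "outer 1 \<xi>s"] sum.distrib[symmetric]
      using sub(2)[OF domXh] by (intro sum_mono) (simp add: Xs_nth)
    moreover have "stack_fun f Xs + stack_gradient f Xs \<bullet> (Xh - Xs) \<le> stack_fun f Xh"
      by (rule stack_fun_gradient_le[OF f_convex diff])
    ultimately have "- (Ys \<bullet> (Xh - Xs)) \<le> h Xh - h Xs"
      by (simp add: Ys h_def inner_diff_left)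
    moreover have "Ys \<bullet> (Xh - Xs) = Ys \<bullet> P Xh"
      using inner_centering[OF Ys0, of Xh] Ys0 by (simp add: inner_diff_right Xs inner_outer_one P_def)
    moreover have "Ys \<bullet> P Xh \<le> norm Ys * norm (P Xh)" by (rule norm_cauchy_schwarz)
    ultimately show ?thesis by simp
  qed

  \<comment> \<open>Both terms of the merit function\<close>
  have composite: "composite f G U = ereal (h U)" if "\<And>i. U $ i \<in> effective_domain G" for U
    using that by (simp add: composite_def stack_reg_eq[OF G_proper] h_def g_def)
  \<comment> \<open>Adding \<open>upper\<close> and \<open>lower\<close> bounds the consensus term
    by \<open>R\<close>. Then \<open>upper\<close> bounds the gap from above, and
    \<open>lower\<close> with the consensus bound from below.\<close>
  have "0 \<le> norm Ys * norm (P Xh)" by simp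
  with upper lower have "norm Ys * norm (P Xh) \<le> R" "\<bar>h Xh - h Xs\<bar> \<le> R"
    by linarith+
  then have "merit f G Xs Ys Xh \<le> ereal R"
    using sub(1) unfolding merit_def by (simp add: composite domXh Xs_nth P_def mult.commute)
  then show "merit f G Xs Ys ((1 / real k) *\<^sub>R (\<Sum>t=1..k. X t))
           \<le> ereal ((1 / real k) * (1 / (2 * \<gamma>) * sq_norm_wrt D (X 0 - Xs)
                + 2 * \<gamma> * (1 / lambda_2 C) * (norm (stack_gradient f Xs))\<^sup>2))"
    unfolding Xh_def R_def .
qed

end
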